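(* Let $a,b,c$ be arbitrary nonzero constants and let $L_5$ be the five-dimensional Lie algebra spanned by the vector fields $$v_1=\tfrac13 x\,\partial_x+\tfrac13 y\,\partial_y+t\,\partial_t+\frac{-2ax-3u}{9}\,\partial_u+\frac{-12cv-2b}{18c}\,\partial_v,\quad v_2=\partial_t,\quad v_3=\partial_x,\quad v_4=\partial_y,\quad v_5=\partial_u$$ on the space with coordinates $(x,y,t,u,v)$. Then the optimal system of one-dimensional subalgebras of $L_5$ is $$Z=a_1v_1,\qquad Z=a_2v_2+a_3v_3+a_4v_4+a_5v_5,$$ where $a_1\neq 0$ in the first form and $a_2,a_3,a_4,a_5$ are real coefficients, not all zero, in the second.
   Context: The adjoint action is given by $\mathrm{Ad}(\exp(\varepsilon v_i))v_j=v_j-\varepsilon[v_i,v_j]+\tfrac12\varepsilon^2[v_i,[v_i,v_j]]-\cdots$ for real $\varepsilon$, where $[\cdot,\cdot]$ is the commutator of vector fields. Two subalgebras of $L_5$ are similar (equivalent) if they are connected by a transformation from the symmetry group, i.e. if one is carried to the other by a composition of the maps $\mathrm{Ad}(\exp(\varepsilon_i v_i))$, $i=1,\dots,5$. Similar subalgebras are combined into a single class, and an optimal system of one-dimensional subalgebras is the set of generators obtained by selecting a representative from each class. The coefficients $a_1,\dots,a_5$ are unrelated to the constant $a$.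
   Formalization: The whole list has similar members (v2+v4 and e^ε v2+e^(ε/3) v4), so it is not itself optimal; proved instead: each listed Z lies in an optimal system from the list, each class meets exactly one form, and listed Z are similar iff Ad(exp(εv1)) relates their spans. *)

theory Defs
  imports "HOL-Analysis.Analysis" "HOL-Library.Function_Algebras"
begin

text \<open>Functions form a real vector space under the pointwise operations, so that the library
  notions \<^term>\<open>span\<close>, \<^term>\<open>subspace\<close> and \<^term>\<open>dim\<close> apply to vector fields.\<close>

instantiation "fun" :: (type, real_vector) real_vector
begin

definition scaleR_fun :: "real \<Rightarrow> ('a \<Rightarrow> 'b) \<Rightarrow> 'a \<Rightarrow> 'b"
  where "scaleR_fun r f = (\<lambda>x. r *\<^sub>R f x)"

instance
  by standard (simp_all add: scaleR_fun_def fun_eq_iff algebra_simps)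

end

text \<open>A vector field is represented by its coefficient functions: \<open>X\<close> stands for the derivation
  \<open>f \<mapsto> (\<lambda>p. Df(p)(X p))\<close>. The commutator \<open>X \<circ> Y - Y \<circ> X\<close> of two such derivations has the
  coefficient functions below.\<close>

definition lie_bracket ::
  "('a::real_normed_vector \<Rightarrow> 'a) \<Rightarrow> ('a \<Rightarrow> 'a) \<Rightarrow> 'a \<Rightarrow> 'a"
  where "lie_bracket X Y =
    (\<lambda>p. frechet_derivative Y (at p) (X p) - frechet_derivative X (at p) (Y p))"

definition Ad_exp ::
  "real \<Rightarrow> ('a::real_normed_vector \<Rightarrow> 'a) \<Rightarrow> ('a \<Rightarrow> 'a) \<Rightarrow> 'a \<Rightarrow> 'a"
  where "Ad_exp \<epsilon> X Y =
    (\<lambda>p. \<Sum>n. ((- \<epsilon>) ^ n / fact n) *\<^sub>R (lie_bracket X ^^ n) Y p)"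

definition lie_subalgebra :: "('a::real_normed_vector \<Rightarrow> 'a) set \<Rightarrow> bool"
  where "lie_subalgebra S \<longleftrightarrow> subspace S \<and> (\<forall>X\<in>S. \<forall>Y\<in>S. lie_bracket X Y \<in> S)"

definition one_dim_subalgebra ::
  "('a::real_normed_vector \<Rightarrow> 'a) set \<Rightarrow> ('a \<Rightarrow> 'a) set \<Rightarrow> bool"
  where "one_dim_subalgebra L S \<longleftrightarrow> S \<subseteq> L \<and> lie_subalgebra S \<and> dim S = 1"

text \<open>\<open>B\<close> is the chosen basis \<open>v\<^sub>1, v\<^sub>2, \<dots>\<close> of the Lie algebra; compositions may be of any finite
  length and in any order.\<close>

inductive_set adjoint_group ::
  "('a::real_normed_vector \<Rightarrow> 'a) set \<Rightarrow> (('a \<Rightarrow> 'a) \<Rightarrow> 'a \<Rightarrow> 'a) set"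
  for B :: "('a \<Rightarrow> 'a) set"
  where
    id: "id \<in> adjoint_group B"
  | comp: "\<phi> \<in> adjoint_group B \<Longrightarrow> X \<in> B \<Longrightarrow> Ad_exp \<epsilon> X \<circ> \<phi> \<in> adjoint_group B"

definition similar ::
  "('a::real_normed_vector \<Rightarrow> 'a) set \<Rightarrow> ('a \<Rightarrow> 'a) set \<Rightarrow> ('a \<Rightarrow> 'a) set \<Rightarrow> bool"
  where "similar B S T \<longleftrightarrow> (\<exists>\<phi>\<in>adjoint_group B. \<phi> ` S = T)"

text \<open>A set of generators, exactly one for each similarity class of one-dimensional
  subalgebras.\<close>

definition optimal_system ::
  "('a::real_normed_vector \<Rightarrow> 'a) set \<Rightarrow> ('a \<Rightarrow> 'a) set \<Rightarrow> bool"
  where "optimal_system B R \<longleftrightarrow>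
    (\<forall>Z\<in>R. one_dim_subalgebra (span B) (span {Z})) \<and>
    (\<forall>S. one_dim_subalgebra (span B) S \<longrightarrow> (\<exists>!Z. Z \<in> R \<and> similar B S (span {Z})))"

text \<open>The coordinates are \<open>(x, y, t, u, v)\<close>.\<close>

type_synonym point = "real \<times> real \<times> real \<times> real \<times> real"

definition v1 :: "real \<Rightarrow> real \<Rightarrow> real \<Rightarrow> point \<Rightarrow> point"
  where "v1 a b c = (\<lambda>(x, y, t, u, v).
    (x / 3, y / 3, t, (- 2 * a * x - 3 * u) / 9, (- 12 * c * v - 2 * b) / (18 * c)))"

definition v2 :: "point \<Rightarrow> point" where "v2 = (\<lambda>_. (0, 0, 1, 0, 0))"
definition v3 :: "point \<Rightarrow> point" where "v3 = (\<lambda>_. (1, 0, 0, 0, 0))"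
definition v4 :: "point \<Rightarrow> point" where "v4 = (\<lambda>_. (0, 1, 0, 0, 0))"
definition v5 :: "point \<Rightarrow> point" where "v5 = (\<lambda>_. (0, 0, 0, 1, 0))"

definition L5_basis :: "real \<Rightarrow> real \<Rightarrow> real \<Rightarrow> (point \<Rightarrow> point) set"
  where "L5_basis a b c = {v1 a b c, v2, v3, v4, v5}"

definition form1 :: "real \<Rightarrow> real \<Rightarrow> real \<Rightarrow> (point \<Rightarrow> point) set"
  where "form1 a b c = {a1 *\<^sub>R v1 a b c | a1. a1 \<noteq> 0}"

definition form2 :: "(point \<Rightarrow> point) set"
  where "form2 = {a2 *\<^sub>R v2 + a3 *\<^sub>R v3 + a4 *\<^sub>R v4 + a5 *\<^sub>R v5 | a2 a3 a4 a5.
    \<not> (a2 = 0 \<and> a3 = 0 \<and> a4 = 0 \<and> a5 = 0)}"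

text \<open>\<open>L\<^sub>5\<close> is a five-dimensional Lie algebra, and the series in \<^const>\<open>Ad_exp\<close> converges on it.\<close>

definition L5_elem :: "real \<Rightarrow> real \<Rightarrow> real \<Rightarrow> real \<Rightarrow> real \<Rightarrow> real \<Rightarrow> real \<Rightarrow> real \<Rightarrow> point \<Rightarrow> point"
  where "L5_elem a b c a1 a2 a3 a4 a5 =
    a1 *\<^sub>R v1 a b c + a2 *\<^sub>R v2 + a3 *\<^sub>R v3 + a4 *\<^sub>R v4 + a5 *\<^sub>R v5"

lemma L5_elem_apply:
  "L5_elem a b c a1 a2 a3 a4 a5 (x, y, t, u, v) =
    (a1 * x / 3 + a3, a1 * y / 3 + a4, a1 * t + a2,
     a1 * (- 2 * a * x - 3 * u) / 9 + a5, a1 * (- 12 * c * v - 2 * b) / (18 * c))"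
  by (simp add: L5_elem_def v1_def v2_def v3_def v4_def v5_def scaleR_fun_def)

lemma span_L5_basis:
  "X \<in> span (L5_basis a b c) \<longleftrightarrow> (\<exists>a1 a2 a3 a4 a5. X = L5_elem a b c a1 a2 a3 a4 a5)"
proof -
  have "X \<in> span (L5_basis a b c) \<longleftrightarrow> (\<exists>a1 a2 a3 a4 a5.
      X - a1 *\<^sub>R v1 a b c - a2 *\<^sub>R v2 - a3 *\<^sub>R v3 - a4 *\<^sub>R v4 - a5 *\<^sub>R v5 = 0)"
    unfolding L5_basis_def span_insert span_empty by simp
  also have "\<dots> \<longleftrightarrow> (\<exists>a1 a2 a3 a4 a5. X = L5_elem a b c a1 a2 a3 a4 a5)"
    unfolding L5_elem_def by (simp only: diff_diff_eq right_minus_eq)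
  finally show ?thesis .
qed

lemma L5_elem_has_derivative:
  "(L5_elem a b c a1 a2 a3 a4 a5 has_derivative
     (\<lambda>(x, y, t, u, v). (a1 * x / 3, a1 * y / 3, a1 * t,
        a1 * (- 2 * a * x - 3 * u) / 9, a1 * (- 12 * c * v) / (18 * c)))) (at p)"
proof -
  let ?D = "\<lambda>(x, y, t, u, v). (a1 * x / 3, a1 * y / 3, a1 * t,
        a1 * (- 2 * a * x - 3 * u) / 9, a1 * (- 12 * c * v) / (18 * c))"
  have *: "L5_elem a b c a1 a2 a3 a4 a5 =
      (\<lambda>p. ?D p + (a3, a4, a2, a5, a1 * (- 2 * b) / (18 * c)))"
    by (rule ext, clarify, unfold L5_elem_apply) (simp add: diff_divide_distrib algebra_simps)
  have "linear ?D"
    by (rule linearI) (auto simp: algebra_simps diff_divide_distrib add_divide_distrib)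
  then have "bounded_linear ?D"
    by (simp add: linear_linear)
  then show ?thesis
    unfolding * by (intro has_derivative_add_const bounded_linear_imp_has_derivative)
qed

lemma lie_bracket_L5:
  assumes "c \<noteq> 0"
  shows "lie_bracket (L5_elem a b c a1 a2 a3 a4 a5) (L5_elem a b c b1 b2 b3 b4 b5) =
    L5_elem a b c 0 (a2 * b1 - a1 * b2) ((a3 * b1 - a1 * b3) / 3) ((a4 * b1 - a1 * b4) / 3)
      (2 * a / 9 * (a1 * b3 - a3 * b1) + (a1 * b5 - a5 * b1) / 3)"
  unfolding lie_bracket_def L5_elem_has_derivative[THEN frechet_derivative_at, symmetric]
proof (rule ext)
  fix p :: point
  obtain x y t u v where p: "p = (x, y, t, u, v)"
    by (metis prod.exhaust)
  have *: "k * (- 12 * c * w) / (18 * c) = - 2 / 3 * k * w" for k w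
    using assms by simp
  have **: "k * (- 12 * c * w - 2 * b) / (18 * c) = - 2 / 3 * k * w - k * b / (9 * c)" for k w
    using assms by (simp add: field_simps)
  show "(case L5_elem a b c a1 a2 a3 a4 a5 p of (x, y, t, u, v) \<Rightarrow> (b1 * x / 3, b1 * y / 3, b1 * t,
        b1 * (- 2 * a * x - 3 * u) / 9, b1 * (- 12 * c * v) / (18 * c))) -
     (case L5_elem a b c b1 b2 b3 b4 b5 p of (x, y, t, u, v) \<Rightarrow> (a1 * x / 3, a1 * y / 3, a1 * t,
        a1 * (- 2 * a * x - 3 * u) / 9, a1 * (- 12 * c * v) / (18 * c))) =
    L5_elem a b c 0 (a2 * b1 - a1 * b2) ((a3 * b1 - a1 * b3) / 3) ((a4 * b1 - a1 * b4) / 3)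
      (2 * a / 9 * (a1 * b3 - a3 * b1) + (a1 * b5 - a5 * b1) / 3) p"
    unfolding p L5_elem_apply prod.case * **
    by (simp add: algebra_simps diff_divide_distrib add_divide_distrib)
qed

lemma L5_elem_eq_0:
  "L5_elem a b c a1 a2 a3 a4 a5 = 0 \<longleftrightarrow> a1 = 0 \<and> a2 = 0 \<and> a3 = 0 \<and> a4 = 0 \<and> a5 = 0"
    (is "?L \<longleftrightarrow> ?R")
proof
  assume ?L
  then have "L5_elem a b c a1 a2 a3 a4 a5 p = 0" for p
    by simp
  from this[of "(0, 0, 0, 0, 0)"] this[of "(0, 1, 0, 0, 0)"] show ?R
    by (simp add: L5_elem_apply zero_prod_def)
qed (simp add: L5_elem_def)

lemma lie_subalgebra_L5:
  assumes "c \<noteq> 0"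
  shows "lie_subalgebra (span (L5_basis a b c))"
  unfolding lie_subalgebra_def
proof (intro conjI ballI)
  fix X Y assume "X \<in> span (L5_basis a b c)" "Y \<in> span (L5_basis a b c)"
  then show "lie_bracket X Y \<in> span (L5_basis a b c)"
    unfolding span_L5_basis using lie_bracket_L5[OF assms] by metis
qed simp

lemma dim_L5: "dim (span (L5_basis a b c)) = 5"
proof -
  note ne = L5_elem_eq_0[where a = a and b = b and c = c, unfolded L5_elem_def, THEN iffD1]
  have n5: "v5 \<noteq> 0"
    using ne[of 0 0 0 0 1] by auto
  have n4: "v4 \<notin> span {v5}"
    unfolding span_insert span_empty using ne[of 0 0 0 1 "- k5" for k5] by auto
  have n3: "v3 \<notin> span {v4, v5}"
  proof
    assume "v3 \<in> span {v4, v5}"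
    then obtain k4 k5 where "v3 - k4 *\<^sub>R v4 - k5 *\<^sub>R v5 = 0"
      unfolding span_insert span_empty by auto
    then show False
      using ne[of 0 0 1 "- k4" "- k5"] by simp
  qed
  have n2: "v2 \<notin> span {v3, v4, v5}"
  proof
    assume "v2 \<in> span {v3, v4, v5}"
    then obtain k3 k4 k5 where "v2 - k3 *\<^sub>R v3 - k4 *\<^sub>R v4 - k5 *\<^sub>R v5 = 0"
      unfolding span_insert span_empty by auto
    then show False
      using ne[of 0 1 "- k3" "- k4" "- k5"] by simp
  qed
  have n1: "v1 a b c \<notin> span {v2, v3, v4, v5}"
  proof
    assume "v1 a b c \<in> span {v2, v3, v4, v5}"
    then obtain k2 k3 k4 k5 where
      "v1 a b c - k2 *\<^sub>R v2 - k3 *\<^sub>R v3 - k4 *\<^sub>R v4 - k5 *\<^sub>R v5 = 0"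
      unfolding span_insert span_empty by auto
    then show False
      using ne[of 1 "- k2" "- k3" "- k4" "- k5"] by simp
  qed
  note n = n1 n2 n3 n4 n5
  have "independent (L5_basis a b c)"
    unfolding L5_basis_def
    by (intro independent_insertI) (use n in \<open>auto simp: independent_empty\<close>)
  moreover have "card (L5_basis a b c) = 5"
  proof -
    have "v4 \<notin> {v5}" "v3 \<notin> {v4, v5}" "v2 \<notin> {v3, v4, v5}" "v1 a b c \<notin> {v2, v3, v4, v5}"
      using n by (metis span_base)+
    then show ?thesis
      unfolding L5_basis_def by simp
  qed
  ultimately show ?thesis
    using dim_eq_card_independent dim_span by metis
qed

lemma Ad_exp_summable:
  assumes "c \<noteq> 0" "X \<in> L5_basis a b c" "Y \<in> span (L5_basis a b c)"
  shows "summable (\<lambda>n. ((- \<epsilon>) ^ n / fact n) *\<^sub>R (lie_bracket X ^^ n) Y p)"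
proof -
  note br = lie_bracket_L5[OF assms(1), of a b]
  obtain a1 a2 a3 a4 a5 where Y: "Y = L5_elem a b c a1 a2 a3 a4 a5"
    using assms(3) unfolding span_L5_basis by auto
  consider (1) "X = v1 a b c" | (2) k2 k3 k4 k5 where "X = L5_elem a b c 0 k2 k3 k4 k5"
  proof -
    have "v2 = L5_elem a b c 0 1 0 0 0" "v3 = L5_elem a b c 0 0 1 0 0"
        "v4 = L5_elem a b c 0 0 0 1 0" "v5 = L5_elem a b c 0 0 0 0 1"
      by (simp_all add: L5_elem_def)
    then show ?thesis
      using assms(2) that unfolding L5_basis_def by blast
  qed
  then show ?thesis
  proof cases
    case 1
    then have X: "X = L5_elem a b c 1 0 0 0 0"
      by (simp add: L5_elem_def)
    have pow: "(lie_bracket X ^^ Suc n) Y =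
        L5_elem a b c 0 ((- 1) ^ Suc n * a2) ((- 1 / 3) ^ Suc n * a3) ((- 1 / 3) ^ Suc n * a4)
          ((1 / 3) ^ Suc n * (a5 + a * a3 / 3) - a * a3 / 3 * (- 1 / 3) ^ Suc n)" for n
    proof (induction n)
      case 0
      show ?case
        unfolding X Y by (simp add: br algebra_simps)
    next
      case (Suc n)
      show ?case
        unfolding funpow.simps(2)[of "Suc n"] o_apply Suc
        unfolding X br by (simp add: algebra_simps diff_divide_distrib add_divide_distrib)
    qed
    define g where "g r n = (- \<epsilon> * r) ^ Suc n / fact (Suc n)" for r n
    have "summable (\<lambda>n. (- \<epsilon> * r) ^ n / fact n)" for r
      using summable_exp[of "- \<epsilon> * r"] by (simp add: divide_inverse mult.commute)
    then have g: "summable (g r)" for r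
      unfolding g_def by (subst summable_Suc_iff)
    have "((- \<epsilon>) ^ Suc n / fact (Suc n)) *\<^sub>R (lie_bracket X ^^ Suc n) Y p =
        (g (- 1) n * a2) *\<^sub>R v2 p + (g (- 1 / 3) n * a3) *\<^sub>R v3 p + (g (- 1 / 3) n * a4) *\<^sub>R v4 p
        + (g (1 / 3) n * (a5 + a * a3 / 3) - g (- 1 / 3) n * (a * a3 / 3)) *\<^sub>R v5 p" for n
    proof -
      have e: "(- \<epsilon>) ^ Suc n / fact (Suc n) * r ^ Suc n = g r n" for r
        unfolding g_def power_mult_distrib by simp
      define q where "q = (- \<epsilon>) ^ Suc n / fact (Suc n)"
      show ?thesis
        unfolding pow e[symmetric] q_def[symmetric]
        by (simp only: L5_elem_def plus_fun_def scaleR_fun_def scaleR_add_right scaleR_scaleR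
            scaleR_zero_left right_diff_distrib mult_zero_right ac_simps add_0)
    qed
    moreover have "summable (\<lambda>n. (g (- 1) n * a2) *\<^sub>R v2 p + (g (- 1 / 3) n * a3) *\<^sub>R v3 p
        + (g (- 1 / 3) n * a4) *\<^sub>R v4 p
        + (g (1 / 3) n * (a5 + a * a3 / 3) - g (- 1 / 3) n * (a * a3 / 3)) *\<^sub>R v5 p)"
      by (intro summable_add summable_diff summable_scaleR_left summable_mult2 g)
    ultimately have "summable (\<lambda>n. ((- \<epsilon>) ^ Suc n / fact (Suc n)) *\<^sub>R (lie_bracket X ^^ Suc n) Y p)"
      by simp
    then show ?thesis
      by (subst (asm) summable_Suc_iff)
  next
    case 2
    have z: "L5_elem a b c 0 0 0 0 0 = (\<lambda>_. 0)"
      by (simp add: L5_elem_def scaleR_fun_def fun_eq_iff)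
    have 0: "(lie_bracket X ^^ (n + 2)) Y = 0" for n
    proof (induction n)
      case 0
      show ?case
        unfolding 2 Y by (simp add: numeral_2_eq_2 br z zero_fun_def)
    next
      case (Suc n)
      have "lie_bracket X 0 = 0"
        using br[of 0 k2 k3 k4 k5 0 0 0 0 0] L5_elem_eq_0[of a b c 0 0 0 0 0] unfolding 2 by simp
      with Suc show ?case
        by (simp add: zero_fun_def)
    qed
    have "summable (\<lambda>n. ((- \<epsilon>) ^ (n + 2) / fact (n + 2)) *\<^sub>R (lie_bracket X ^^ (n + 2)) Y p)"
      unfolding 0 by simp
    then show ?thesis
      by (subst (asm) summable_iff_shift)
  qed
qed

end

theory Submission
  imports Defs
begin

text \<open>The coefficient of \<open>v\<^sub>1\<close> is invariant under the adjoint group. If it is nonzero, the maps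
  \<open>Ad(exp(\<epsilon> v\<^sub>i))\<close> with \<open>i = 2, \<dots>, 5\<close> remove the other four coefficients one after the other.
  If it is zero, these four maps act trivially, because \<open>v\<^sub>2, \<dots>, v\<^sub>5\<close> commute; so an adjoint map
  acts there like the flow of \<open>v\<^sub>1\<close> alone.\<close>

section \<open>Similarity and one-dimensional subalgebras in an arbitrary algebra of vector
  fields\<close>

text \<open>The inductive definition only adds single factors on the left; transitivity of
  \<open>similar\<close> and the construction of inverses compose whole elements.\<close>

lemma adjoint_group_comp:
  assumes "\<psi> \<in> adjoint_group B" and "\<phi> \<in> adjoint_group B"
  shows "\<psi> \<circ> \<phi> \<in> adjoint_group B"
  using assms(1)
proof induction
  case id
  then show ?case
    using assms(2) by simp
next
  case (comp \<psi> X \<epsilon>)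
  then show ?case
    using adjoint_group.comp by (metis comp_assoc)
qed

lemma Ad_exp_in_adjoint_group:
  "X \<in> B \<Longrightarrow> Ad_exp \<epsilon> X \<in> adjoint_group B"
  using adjoint_group.comp[OF adjoint_group.id] by fastforce

lemma similar_refl: "similar B S S"
  unfolding similar_def using adjoint_group.id by (metis image_id id_apply)

lemma similar_trans:
  "similar B S T \<Longrightarrow> similar B T U \<Longrightarrow> similar B S U"
  unfolding similar_def using adjoint_group_comp by (metis image_comp)

lemma span_scaleR_singleton:
  fixes X :: "'a::real_vector"
  assumes "k \<noteq> 0"
  shows "span {k *\<^sub>R X} = span {X}"
proof
  show "span {k *\<^sub>R X} \<subseteq> span {X}"
    by (intro span_minimal) (auto intro: span_scale span_base)
  have "X = inverse k *\<^sub>R (k *\<^sub>R X)"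
    using assms by simp
  then have "X \<in> span {k *\<^sub>R X}"
    by (metis span_scale span_base singletonI)
  then show "span {X} \<subseteq> span {k *\<^sub>R X}"
    by (intro span_minimal) auto
qed

lemma one_dim_subalgebraE:
  assumes "one_dim_subalgebra L S"
  obtains X where "X \<in> L" "X \<noteq> 0" "S = span {X}"
proof -
  have S: "S \<subseteq> L" "subspace S" "dim S = 1"
    using assms by (auto simp: one_dim_subalgebra_def lie_subalgebra_def)
  obtain B where B: "B \<subseteq> S" "independent B" "S \<subseteq> span B" "card B = dim S"
    using basis_exists by blast
  then obtain X where X: "B = {X}"
    using S(3) by (metis card_1_singletonE)
  have "S = span {X}"
    using B S(2) X by (metis span_minimal subset_antisym)
  moreover have "X \<noteq> 0"
    using B(2) X dependent_zero by blast
  ultimately show ?thesis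
    using that B(1) S(1) X by blast
qed

text \<open>One member is chosen from each similarity class within \<open>F\<close>, the choice
  being forced to \<open>Z\<close> in the class of \<open>Z\<close>. Symmetry is a hypothesis
  because elements of \<open>adjoint_group\<close> are merely compositions of series, with no
  inverse supplied by the definition.\<close>

lemma optimal_system_exists:
  assumes one_dim: "\<And>Z. Z \<in> F \<Longrightarrow> one_dim_subalgebra (span B) (span {Z})"
    and cover: "\<And>S. one_dim_subalgebra (span B) S \<Longrightarrow> \<exists>Z\<in>F. similar B S (span {Z})"
    and sym: "\<And>S T. one_dim_subalgebra (span B) S \<Longrightarrow> similar B S T \<Longrightarrow> similar B T S"
    and Z: "Z \<in> F"
  shows "\<exists>R\<subseteq>F. Z \<in> R \<and> optimal_system B R"
proof -
  define cls where "cls W = {V\<in>F. similar B (span {W}) (span {V})}" for W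
  \<comment> \<open>The argument is the class as a set, so similar generators receive literally the
    same representative.\<close>
  define rep where "rep C = (if Z \<in> C then Z else (SOME V. V \<in> C))" for C
  define R where "R = (\<lambda>W. rep (cls W)) ` F"
  have rep: "rep (cls W) \<in> cls W" if "W \<in> F" for W
  proof -
    have "W \<in> cls W"
      using that similar_refl by (simp add: cls_def)
    then show ?thesis
      unfolding rep_def by (metis someI)
  qed
  have cls_eq: "cls V = cls W"
    if "V \<in> F" "W \<in> F" "similar B (span {V}) (span {W})" for V W
    unfolding cls_def using that sym[OF one_dim] by (blast intro: similar_trans)
  have "R \<subseteq> F"
    using rep unfolding R_def cls_def by blast
  moreover have "Z \<in> R"
  proof -
    have "Z \<in> cls Z"
      using Z similar_refl by (simp add: cls_def)
    then have "rep (cls Z) = Z"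
      by (simp add: rep_def)
    then show ?thesis
      unfolding R_def using Z by (metis imageI)
  qed
  moreover have "optimal_system B R"
    unfolding optimal_system_def
  proof (intro conjI ballI allI impI)
    show "one_dim_subalgebra (span B) (span {V})" if "V \<in> R" for V
      using that \<open>R \<subseteq> F\<close> one_dim by blast
  next
    fix S assume S: "one_dim_subalgebra (span B) S"
    then obtain W where W: "W \<in> F" "similar B S (span {W})"
      using cover by blast
    have "similar B (span {W}) (span {rep (cls W)})"
      using rep[OF W(1)] by (simp add: cls_def)
    then have "rep (cls W) \<in> R \<and> similar B S (span {rep (cls W)})"
      unfolding R_def using W similar_trans by blast
    moreover have "V = rep (cls W)" if V: "V \<in> R" "similar B S (span {V})" for V
    proof -
      obtain U where U: "U \<in> F" "V = rep (cls U)"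
        using V(1) unfolding R_def by blast
      then have "similar B (span {U}) (span {V})"
        using rep unfolding cls_def by blast
      moreover have "similar B (span {V}) (span {W})"
        using sym[OF S V(2)] W(2) similar_trans by blast
      ultimately have "cls U = cls W"
        using cls_eq U(1) W(1) similar_trans by blast
      then show ?thesis
        using U(2) by simp
    qed
    ultimately show "\<exists>!V. V \<in> R \<and> similar B S (span {V})"
      by blast
  qed
  ultimately show ?thesis
    by blast
qed

section \<open>Coordinates on \<open>L\<^sub>5\<close>\<close>

lemma scaleR_L5_elem:
  "k *\<^sub>R L5_elem a b c y1 y2 y3 y4 y5 = L5_elem a b c (k * y1) (k * y2) (k * y3) (k * y4) (k * y5)"
  by (simp add: L5_elem_def scaleR_add_right)

lemma L5_elem_in_span [simp]: "L5_elem a b c y1 y2 y3 y4 y5 \<in> span (L5_basis a b c)"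
  unfolding span_L5_basis by blast

lemma generators_eq_L5_elem:
  "v1 a b c = L5_elem a b c 1 0 0 0 0"
  "v2 = L5_elem a b c 0 1 0 0 0"
  "v3 = L5_elem a b c 0 0 1 0 0"
  "v4 = L5_elem a b c 0 0 0 1 0"
  "v5 = L5_elem a b c 0 0 0 0 1"
  by (simp_all add: L5_elem_def)

text \<open>On \<open>L\<^sub>5\<close> the y-component at a point is
  \<open>a1 * y / 3 + a4\<close>, so its increment from \<open>y = 0\<close> to \<open>y = 1\<close>
  is a third of the first coordinate. Reading it from values makes it a total function of the vector
  field, without choosing coordinates.\<close>

definition v1_coeff :: "(point \<Rightarrow> point) \<Rightarrow> real"
  where "v1_coeff X = 3 * (fst (snd (X (0, 1, 0, 0, 0))) - fst (snd (X 0)))"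

lemma v1_coeff_L5_elem [simp]: "v1_coeff (L5_elem a b c y1 y2 y3 y4 y5) = y1"
  by (simp add: v1_coeff_def L5_elem_apply zero_prod_def)

lemma v1_coeff_scaleR [simp]: "v1_coeff (k *\<^sub>R X) = k * v1_coeff X"
  by (simp add: v1_coeff_def scaleR_fun_def algebra_simps)

section \<open>Closed formulas for the adjoint maps\<close>

text \<open>The bracket with \<open>v1\<close> is diagonalizable: \<open>v1\<close>,
  \<open>v2\<close>, \<open>v4\<close>, \<open>v5\<close> are eigenvectors for 0, -1, -1/3, 1/3, and
  \<open>v3 - (a / 3) *\<^sub>R v5\<close> is one for -1/3. Splitting
  \<open>y3 *\<^sub>R v3 + y5 *\<^sub>R v5\<close> along the last eigenvector and \<open>v5\<close>
  yields the final coordinate. The factor \<open>0 ^ n\<close> keeps the \<open>v1\<close> part for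
  \<open>n = 0\<close> only.\<close>

lemma lie_bracket_v1_funpow:
  assumes "c \<noteq> 0"
  shows "(lie_bracket (v1 a b c) ^^ n) (L5_elem a b c y1 y2 y3 y4 y5) =
    L5_elem a b c (0 ^ n * y1) ((- 1) ^ n * y2) ((- 1 / 3) ^ n * y3) ((- 1 / 3) ^ n * y4)
      ((1 / 3) ^ n * (y5 + a * y3 / 3) - (- 1 / 3) ^ n * (a * y3 / 3))"
proof (induction n)
  case (Suc n)
  show ?case
    unfolding funpow.simps o_apply Suc
    unfolding generators_eq_L5_elem(1)[of a b c] lie_bracket_L5[OF assms]
    by (simp add: algebra_simps diff_divide_distrib add_divide_distrib)
qed simp

lemma Ad_exp_v1:
  assumes "c \<noteq> 0"
  shows "Ad_exp \<epsilon> (v1 a b c) (L5_elem a b c y1 y2 y3 y4 y5) =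
    L5_elem a b c y1 (exp \<epsilon> * y2) (exp (\<epsilon> / 3) * y3) (exp (\<epsilon> / 3) * y4)
      (exp (- \<epsilon> / 3) * (y5 + a * y3 / 3) - exp (\<epsilon> / 3) * (a * y3 / 3))"
proof
  fix p
  \<comment> \<open>This is the n-th term of the exponential series at
    \<open>- \<epsilon> * r\<close>: the contribution of the eigenvalue \<open>r\<close>. The
    coefficients of the adjoint series are thus combinations of four exponential series.\<close>
  define g where "g r n = (- \<epsilon>) ^ n / fact n * r ^ n" for r n
  have "g r = (\<lambda>n. (- \<epsilon> * r) ^ n /\<^sub>R fact n)" for r
    by (simp only: g_def fun_eq_iff power_mult_distrib) (simp add: field_simps)
  then have g: "g r sums exp (- \<epsilon> * r)" for r
    using exp_converges[of "- \<epsilon> * r"] by simp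
  have "((- \<epsilon>) ^ n / fact n) *\<^sub>R (lie_bracket (v1 a b c) ^^ n) (L5_elem a b c y1 y2 y3 y4 y5) p =
      (g 0 n * y1) *\<^sub>R v1 a b c p + (g (- 1) n * y2) *\<^sub>R v2 p + (g (- 1 / 3) n * y3) *\<^sub>R v3 p
      + (g (- 1 / 3) n * y4) *\<^sub>R v4 p
      + (g (1 / 3) n * (y5 + a * y3 / 3) - g (- 1 / 3) n * (a * y3 / 3)) *\<^sub>R v5 p" for n
    unfolding lie_bracket_v1_funpow[OF assms] g_def
    by (simp only: L5_elem_def plus_fun_def scaleR_fun_def scaleR_add_right scaleR_scaleR
        right_diff_distrib mult.assoc)
  moreover have "(\<lambda>n. (g 0 n * y1) *\<^sub>R v1 a b c p + (g (- 1) n * y2) *\<^sub>R v2 p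
        + (g (- 1 / 3) n * y3) *\<^sub>R v3 p + (g (- 1 / 3) n * y4) *\<^sub>R v4 p
        + (g (1 / 3) n * (y5 + a * y3 / 3) - g (- 1 / 3) n * (a * y3 / 3)) *\<^sub>R v5 p) sums
      ((exp (- \<epsilon> * 0) * y1) *\<^sub>R v1 a b c p + (exp (- \<epsilon> * - 1) * y2) *\<^sub>R v2 p
        + (exp (- \<epsilon> * (- 1 / 3)) * y3) *\<^sub>R v3 p + (exp (- \<epsilon> * (- 1 / 3)) * y4) *\<^sub>R v4 p
        + (exp (- \<epsilon> * (1 / 3)) * (y5 + a * y3 / 3)
           - exp (- \<epsilon> * (- 1 / 3)) * (a * y3 / 3)) *\<^sub>R v5 p)"
    by (intro sums_add sums_diff sums_scaleR_left sums_mult2 g)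
  ultimately show "Ad_exp \<epsilon> (v1 a b c) (L5_elem a b c y1 y2 y3 y4 y5) p =
    L5_elem a b c y1 (exp \<epsilon> * y2) (exp (\<epsilon> / 3) * y3) (exp (\<epsilon> / 3) * y4)
      (exp (- \<epsilon> / 3) * (y5 + a * y3 / 3) - exp (\<epsilon> / 3) * (a * y3 / 3)) p"
    unfolding Ad_exp_def by (simp add: sums_iff L5_elem_def scaleR_fun_def)
qed

text \<open>Bracketing with \<open>v2\<close>, ..., \<open>v5\<close> or a combination of them sends
  \<open>L\<^sub>5\<close> into their span, which is abelian. The second iterated bracket vanishes
  and the series stops after its linear term.\<close>

lemma Ad_exp_ideal:
  assumes "c \<noteq> 0"
  shows "Ad_exp \<epsilon> (L5_elem a b c 0 k2 k3 k4 k5) (L5_elem a b c y1 y2 y3 y4 y5) =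
    L5_elem a b c y1 (y2 - \<epsilon> * k2 * y1) (y3 - \<epsilon> * k3 * y1 / 3) (y4 - \<epsilon> * k4 * y1 / 3)
      (y5 + \<epsilon> * (2 * a * k3 / 9 + k5 / 3) * y1)"
proof
  fix p
  let ?X = "L5_elem a b c 0 k2 k3 k4 k5" and ?Y = "L5_elem a b c y1 y2 y3 y4 y5"
  note br = lie_bracket_L5[OF assms, of a b]
  have z: "L5_elem a b c 0 0 0 0 0 = 0"
    by (simp add: L5_elem_eq_0)
  have "(lie_bracket ?X ^^ (n + 2)) ?Y = 0" for n
  proof (induction n)
    case 0
    show ?case
      by (simp add: numeral_2_eq_2 br z)
  next
    case (Suc n)
    have "lie_bracket ?X 0 = 0"
      using br[of 0 k2 k3 k4 k5 0 0 0 0 0] by (simp add: z)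
    with Suc show ?case
      by (simp add: zero_fun_def)
  qed
  then have "(lie_bracket ?X ^^ n) ?Y p = 0" if "n \<notin> {..<2}" for n
    using that by (metis le_add_diff_inverse2 lessThan_iff linorder_not_le zero_fun_apply)
  then have "Ad_exp \<epsilon> ?X ?Y p = (\<Sum>n<2. ((- \<epsilon>) ^ n / fact n) *\<^sub>R (lie_bracket ?X ^^ n) ?Y p)"
    unfolding Ad_exp_def by (intro suminf_finite) simp_all
  also have "\<dots> = ?Y p - \<epsilon> *\<^sub>R lie_bracket ?X ?Y p"
    by (simp add: numeral_2_eq_2)
  also have "\<dots> = (?Y - \<epsilon> *\<^sub>R lie_bracket ?X ?Y) p"
    by (simp add: scaleR_fun_def)
  also have "?Y - \<epsilon> *\<^sub>R lie_bracket ?X ?Y =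
      L5_elem a b c y1 (y2 - \<epsilon> * k2 * y1) (y3 - \<epsilon> * k3 * y1 / 3) (y4 - \<epsilon> * k4 * y1 / 3)
        (y5 + \<epsilon> * (2 * a * k3 / 9 + k5 / 3) * y1)"
    unfolding br by (simp add: L5_elem_def algebra_simps add_divide_distrib)
  finally show "Ad_exp \<epsilon> ?X ?Y p =
      L5_elem a b c y1 (y2 - \<epsilon> * k2 * y1) (y3 - \<epsilon> * k3 * y1 / 3) (y4 - \<epsilon> * k4 * y1 / 3)
        (y5 + \<epsilon> * (2 * a * k3 / 9 + k5 / 3) * y1) p" .
qed

section \<open>The adjoint group of \<open>L\<^sub>5\<close>: invariance, inverses, action on the
  ideal\<close>

lemma L5_basis_cases:
  assumes "X \<in> L5_basis a b c"
  obtains "X = v1 a b c" | k2 k3 k4 k5 where "X = L5_elem a b c 0 k2 k3 k4 k5"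
  using assms generators_eq_L5_elem[of a b c] unfolding L5_basis_def by blast

text \<open>All four facts are read off the closed formulas. Homogeneity stands in for linearity,
  since only images of lines are considered.\<close>

lemma Ad_exp_L5:
  assumes "c \<noteq> 0" and "X \<in> L5_basis a b c" and "Y \<in> span (L5_basis a b c)"
  shows "Ad_exp \<epsilon> X Y \<in> span (L5_basis a b c)"
    and "Ad_exp \<epsilon> X (k *\<^sub>R Y) = k *\<^sub>R Ad_exp \<epsilon> X Y"
    and "v1_coeff (Ad_exp \<epsilon> X Y) = v1_coeff Y"
    and "Ad_exp (- \<epsilon>) X (Ad_exp \<epsilon> X Y) = Y"
proof -
  note Ad = Ad_exp_v1[OF assms(1), of _ a b] Ad_exp_ideal[OF assms(1), of _ a b]
  obtain y1 y2 y3 y4 y5 where Y: "Y = L5_elem a b c y1 y2 y3 y4 y5"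
    using assms(3) unfolding span_L5_basis by blast
  have "Ad_exp \<epsilon> X Y \<in> span (L5_basis a b c) \<and> Ad_exp \<epsilon> X (k *\<^sub>R Y) = k *\<^sub>R Ad_exp \<epsilon> X Y
      \<and> v1_coeff (Ad_exp \<epsilon> X Y) = v1_coeff Y \<and> Ad_exp (- \<epsilon>) X (Ad_exp \<epsilon> X Y) = Y"
    using assms(2)
  proof (cases rule: L5_basis_cases)
    case 1
    have e: "exp x * exp (- x) = 1" for x :: real
      by (simp flip: exp_add)
    show ?thesis
      unfolding 1 Y scaleR_L5_elem Ad
      by (simp add: algebra_simps e)
  next
    case 2
    show ?thesis
      unfolding 2 Y scaleR_L5_elem Ad
      by (simp add: algebra_simps)
  qed
  then show "Ad_exp \<epsilon> X Y \<in> span (L5_basis a b c)"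
    and "Ad_exp \<epsilon> X (k *\<^sub>R Y) = k *\<^sub>R Ad_exp \<epsilon> X Y"
    and "v1_coeff (Ad_exp \<epsilon> X Y) = v1_coeff Y"
    and "Ad_exp (- \<epsilon>) X (Ad_exp \<epsilon> X Y) = Y"
    by blast+
qed

lemma adjoint_group_L5:
  assumes "c \<noteq> 0" and "\<phi> \<in> adjoint_group (L5_basis a b c)" and "Y \<in> span (L5_basis a b c)"
  shows "\<phi> Y \<in> span (L5_basis a b c)"
    and "\<phi> (k *\<^sub>R Y) = k *\<^sub>R \<phi> Y"
    and "v1_coeff (\<phi> Y) = v1_coeff Y"
proof -
  have "\<phi> Y \<in> span (L5_basis a b c) \<and> \<phi> (k *\<^sub>R Y) = k *\<^sub>R \<phi> Y \<and> v1_coeff (\<phi> Y) = v1_coeff Y"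
    using assms(2) by induction (use Ad_exp_L5[OF assms(1)] assms(3) in simp_all)
  then show "\<phi> Y \<in> span (L5_basis a b c)" "\<phi> (k *\<^sub>R Y) = k *\<^sub>R \<phi> Y"
      "v1_coeff (\<phi> Y) = v1_coeff Y"
    by blast+
qed

lemma adjoint_group_L5_image_span:
  assumes "c \<noteq> 0" and "\<phi> \<in> adjoint_group (L5_basis a b c)" and "Y \<in> span (L5_basis a b c)"
  shows "\<phi> ` span {Y} = span {\<phi> Y}"
  by (simp add: span_singleton image_image adjoint_group_L5(2)[OF assms])

lemma adjoint_group_L5_inverse:
  assumes "c \<noteq> 0" and "\<phi> \<in> adjoint_group (L5_basis a b c)"
  shows "\<exists>\<psi>\<in>adjoint_group (L5_basis a b c). \<forall>Y\<in>span (L5_basis a b c). \<psi> (\<phi> Y) = Y"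
  using assms(2)
proof induction
  case id
  then show ?case
    by (intro bexI[of _ id] adjoint_group.id) simp
next
  case (comp \<phi> X \<epsilon>)
  then obtain \<psi> where \<psi>: "\<psi> \<in> adjoint_group (L5_basis a b c)"
      "\<forall>Y\<in>span (L5_basis a b c). \<psi> (\<phi> Y) = Y"
    by blast
  \<comment> \<open>The new factor is outermost and must be undone first, so its inverse goes on the
    right of \<psi>.\<close>
  have "\<psi> \<circ> Ad_exp (- \<epsilon>) X \<in> adjoint_group (L5_basis a b c)"
    by (intro adjoint_group_comp \<psi>(1) Ad_exp_in_adjoint_group comp.hyps)
  moreover have "(\<psi> \<circ> Ad_exp (- \<epsilon>) X) ((Ad_exp \<epsilon> X \<circ> \<phi>) Y) = Y"
    if "Y \<in> span (L5_basis a b c)" for Y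
    using that \<psi>(2) Ad_exp_L5(4)[OF assms(1) comp.hyps(2)] adjoint_group_L5(1)[OF assms(1) comp.hyps(1)]
    by simp
  ultimately show ?case
    by blast
qed

text \<open>The inverse is known on \<open>L\<^sub>5\<close> only, hence the inclusion required of
  \<open>S\<close>.\<close>

lemma similar_L5_sym:
  assumes "c \<noteq> 0" and "S \<subseteq> span (L5_basis a b c)" and "similar (L5_basis a b c) S T"
  shows "similar (L5_basis a b c) T S"
proof -
  obtain \<phi> where \<phi>: "\<phi> \<in> adjoint_group (L5_basis a b c)" "\<phi> ` S = T"
    using assms(3) unfolding similar_def by blast
  obtain \<psi> where \<psi>: "\<psi> \<in> adjoint_group (L5_basis a b c)"
      "\<forall>Y\<in>span (L5_basis a b c). \<psi> (\<phi> Y) = Y"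
    using adjoint_group_L5_inverse[OF assms(1) \<phi>(1)] by blast
  have "\<psi> ` T = (\<lambda>Y. Y) ` S"
    unfolding \<phi>(2)[symmetric] image_image by (rule image_cong) (use \<psi>(2) assms(2) in auto)
  then show ?thesis
    unfolding similar_def using \<psi>(1) by auto
qed

text \<open>Along a composition the parameters of the \<open>v1\<close> factors add up. The
  resulting \<epsilon> does not depend on \<open>Y\<close>, so one flow map serves a whole
  line.\<close>

lemma adjoint_group_on_ideal:
  assumes "c \<noteq> 0" and "\<phi> \<in> adjoint_group (L5_basis a b c)"
  shows "\<exists>\<epsilon>. \<forall>Y\<in>span (L5_basis a b c). v1_coeff Y = 0 \<longrightarrow> \<phi> Y = Ad_exp \<epsilon> (v1 a b c) Y"
  using assms(2)
proof induction
  case id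
  have "Y = Ad_exp 0 (v1 a b c) Y" if "Y \<in> span (L5_basis a b c)" for Y
    using that unfolding span_L5_basis by (auto simp: Ad_exp_v1[OF assms(1)])
  then show ?case
    by (intro exI[of _ 0]) simp
next
  case (comp \<phi> X \<delta>)
  then obtain \<epsilon> where \<epsilon>: "\<forall>Y\<in>span (L5_basis a b c). v1_coeff Y = 0 \<longrightarrow> \<phi> Y = Ad_exp \<epsilon> (v1 a b c) Y"
    by blast
  show ?case
    using comp.hyps(2)
  proof (cases rule: L5_basis_cases)
    case 1
    have "Ad_exp \<delta> X (Ad_exp \<epsilon> (v1 a b c) Y) = Ad_exp (\<delta> + \<epsilon>) (v1 a b c) Y"
      if Y: "Y \<in> span (L5_basis a b c)" for Y
    proof -
      obtain y1 y2 y3 y4 y5 where Y: "Y = L5_elem a b c y1 y2 y3 y4 y5"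
        using Y unfolding span_L5_basis by blast
      have e: "exp (- x - y) = exp (- x) * exp (- y)" for x y :: real
        by (simp flip: exp_add)
      show ?thesis
        unfolding 1 Y Ad_exp_v1[OF assms(1)]
        by (simp add: algebra_simps add_divide_distrib diff_divide_distrib exp_add e)
    qed
    then show ?thesis
      using \<epsilon> by (intro exI[of _ "\<delta> + \<epsilon>"]) simp
  next
    case 2
    have "Ad_exp \<delta> X Y = Y" if "Y \<in> span (L5_basis a b c)" "v1_coeff Y = 0" for Y
      using that unfolding span_L5_basis 2 by (auto simp: Ad_exp_ideal[OF assms(1)])
    \<comment> \<open>The trivial factor is applied to \<open>\<phi> Y\<close>, which must itself
      still lie in \<open>L\<^sub>5\<close> with zero first coordinate.\<close>
    then show ?thesis
      using \<epsilon> adjoint_group_L5(1,3)[OF assms(1) comp.hyps(1)] by (metis comp_apply)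
  qed
qed

section \<open>Lines in \<open>L\<^sub>5\<close> and the two families of generators\<close>

text \<open>Two multiples of one field commute, so every line is closed under the bracket.\<close>

lemma one_dim_subalgebra_L5:
  assumes "c \<noteq> 0" and "X \<in> span (L5_basis a b c)" and "X \<noteq> 0"
  shows "one_dim_subalgebra (span (L5_basis a b c)) (span {X})"
proof -
  obtain y1 y2 y3 y4 y5 where X: "X = L5_elem a b c y1 y2 y3 y4 y5"
    using assms(2) unfolding span_L5_basis by blast
  have "lie_bracket V W = 0" if "V \<in> span {X}" "W \<in> span {X}" for V W
  proof -
    obtain k l where "V = k *\<^sub>R X" "W = l *\<^sub>R X"
      using \<open>V \<in> span {X}\<close> \<open>W \<in> span {X}\<close> unfolding span_singleton by blast
    then show ?thesis
      unfolding X scaleR_L5_elem by (simp add: lie_bracket_L5[OF assms(1)] L5_elem_eq_0)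
  qed
  then have "lie_subalgebra (span {X})"
    unfolding lie_subalgebra_def by (simp add: span_zero)
  moreover have "span {X} \<subseteq> span (L5_basis a b c)"
    using assms(2) by (intro span_minimal) auto
  moreover have "dim (span {X}) = 1"
    using assms(3) dim_eq_card_independent[of "{X}"] by (simp add: dim_span)
  ultimately show ?thesis
    unfolding one_dim_subalgebra_def by blast
qed

lemma form1_iff:
  "Z \<in> form1 a b c \<longleftrightarrow> (\<exists>k. k \<noteq> 0 \<and> Z = L5_elem a b c k 0 0 0 0)"
  by (auto simp: form1_def L5_elem_def)

text \<open>Here \<open>a\<close>, \<open>b\<close>, \<open>c\<close> are arbitrary: they enter only
  through \<open>v1\<close> with coefficient 0. Later unfoldings have to instantiate them
  explicitly.\<close>

lemma form2_iff:
  "Z \<in> form2 \<longleftrightarrow> (\<exists>y2 y3 y4 y5. Z = L5_elem a b c 0 y2 y3 y4 y5 \<and>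
      \<not> (y2 = 0 \<and> y3 = 0 \<and> y4 = 0 \<and> y5 = 0))"
  by (auto simp: form2_def L5_elem_def)

lemma form_in_L5:
  assumes "Z \<in> form1 a b c \<union> form2"
  shows "Z \<in> span (L5_basis a b c)" and "Z \<noteq> 0"
  using assms unfolding Un_iff form1_iff form2_iff[of _ a b c]
  by (auto simp: L5_elem_eq_0)

lemma v1_coeff_form:
  "Z \<in> form1 a b c \<Longrightarrow> v1_coeff Z \<noteq> 0"
  "Z \<in> form2 \<Longrightarrow> v1_coeff Z = 0"
  unfolding form1_iff form2_iff[of _ a b c] by auto

lemma in_form2:
  assumes "X \<in> span (L5_basis a b c)" and "X \<noteq> 0" and "v1_coeff X = 0"
  shows "X \<in> form2"
proof -
  obtain y1 y2 y3 y4 y5 where X: "X = L5_elem a b c y1 y2 y3 y4 y5"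
    using assms(1) unfolding span_L5_basis by blast
  then show ?thesis
    using assms(2,3) L5_elem_eq_0 form2_iff v1_coeff_L5_elem by metis
qed

lemma similar_form1:
  assumes "c \<noteq> 0" and "X \<in> span (L5_basis a b c)" and "v1_coeff X \<noteq> 0"
  shows "\<exists>Z\<in>form1 a b c. similar (L5_basis a b c) (span {X}) (span {Z})"
proof -
  let ?B = "L5_basis a b c"
  obtain y1 y2 y3 y4 y5 where X: "X = L5_elem a b c y1 y2 y3 y4 y5"
    using assms(2) unfolding span_L5_basis by blast
  have y1: "y1 \<noteq> 0"
    using assms(3) X by simp
  \<comment> \<open>Each parameter solves the linear equation of \<open>Ad_exp_ideal\<close> that
    makes one coordinate vanish. The \<open>v3\<close> map also changes the last coordinate, to
    \<open>y5 + 2 * a / 3 * y3\<close>, which is what the \<open>v5\<close> map has to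
    cancel.\<close>
  define \<phi> where "\<phi> = Ad_exp (- 3 * (y5 + 2 * a / 3 * y3) / y1) v5 \<circ> (Ad_exp (3 * y4 / y1) v4 \<circ>
    (Ad_exp (3 * y3 / y1) v3 \<circ> Ad_exp (y2 / y1) v2))"
  have "\<phi> \<in> adjoint_group ?B"
    unfolding \<phi>_def
    by (intro adjoint_group.comp Ad_exp_in_adjoint_group) (simp_all add: L5_basis_def)
  moreover have "\<phi> X = L5_elem a b c y1 0 0 0 0"
    unfolding \<phi>_def X o_apply generators_eq_L5_elem(2-)[of a b c] Ad_exp_ideal[OF assms(1)]
    using y1 by (simp add: field_simps)
  ultimately have "similar ?B (span {X}) (span {L5_elem a b c y1 0 0 0 0})"
    unfolding similar_def using adjoint_group_L5_image_span[OF assms(1) _ assms(2)] by metis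
  then show ?thesis
    using y1 form1_iff by blast
qed

text \<open>An adjoint map preserves the coefficient exactly, but a generator of the image line is
  determined only up to a nonzero factor \<open>k\<close>. Between subalgebras only the vanishing of
  the coefficient survives.\<close>

lemma similar_L5_v1_coeff:
  assumes "c \<noteq> 0" and "X \<in> span (L5_basis a b c)" and "Y \<noteq> 0"
    and "similar (L5_basis a b c) (span {X}) (span {Y})"
  shows "v1_coeff X = 0 \<longleftrightarrow> v1_coeff Y = 0"
proof -
  obtain \<phi> where \<phi>: "\<phi> \<in> adjoint_group (L5_basis a b c)" "\<phi> ` span {X} = span {Y}"
    using assms(4) unfolding similar_def by blast
  then have *: "span {\<phi> X} = span {Y}"
    using adjoint_group_L5_image_span[OF assms(1) _ assms(2)] by metis
  then have "Y \<in> span {\<phi> X}"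
    by (simp add: span_base)
  then obtain k where k: "Y = k *\<^sub>R \<phi> X"
    unfolding span_singleton by blast
  then have "k \<noteq> 0"
    using assms(3) by auto
  then show ?thesis
    using k adjoint_group_L5(3)[OF assms(1) \<phi>(1) assms(2)] by simp
qed

text \<open>Each family contains proportional generators, which span the same subalgebra, so
  representatives are selected inside the families and any given member can be among them. The
  second conjunct says that the families share no class and together meet all of them; the third
  describes the similarities that remain between members.\<close>

theorem mainTheorem2:
  fixes a b c :: real
  assumes "a \<noteq> 0" and "b \<noteq> 0" and "c \<noteq> 0"
  shows "(\<forall>Z \<in> form1 a b c \<union> form2. \<exists>R \<subseteq> form1 a b c \<union> form2.
            Z \<in> R \<and> optimal_system (L5_basis a b c) R)
       \<and> (\<forall>S. one_dim_subalgebra (span (L5_basis a b c)) S \<longrightarrow>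
            ((\<exists>Z \<in> form1 a b c. similar (L5_basis a b c) S (span {Z})) \<noteq>
             (\<exists>Z \<in> form2. similar (L5_basis a b c) S (span {Z}))))
       \<and> (\<forall>Z \<in> form1 a b c \<union> form2. \<forall>Z' \<in> form1 a b c \<union> form2.
            similar (L5_basis a b c) (span {Z}) (span {Z'}) \<longleftrightarrow>
            (\<exists>\<epsilon>. Ad_exp \<epsilon> (v1 a b c) ` span {Z} = span {Z'}))"
proof (intro conjI ballI allI impI)
  let ?B = "L5_basis a b c" and ?F = "form1 a b c \<union> form2"
  \<comment> \<open>Inequality of truth values is exclusive or. The fact comes first because it also
    supplies the covering hypothesis of \<open>optimal_system_exists\<close>.\<close>
  have dichotomy: "(\<exists>Z\<in>form1 a b c. similar ?B S (span {Z})) \<noteq> (\<exists>Z\<in>form2. similar ?B S (span {Z}))"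
    if "one_dim_subalgebra (span ?B) S" for S
  proof -
    obtain X where X: "X \<in> span ?B" "X \<noteq> 0" "S = span {X}"
      using \<open>one_dim_subalgebra (span ?B) S\<close> by (rule one_dim_subalgebraE)
    have inv: "v1_coeff X = 0 \<longleftrightarrow> v1_coeff Z = 0" if "Z \<in> ?F" "similar ?B S (span {Z})" for Z
      using similar_L5_v1_coeff[OF assms(3) X(1)] form_in_L5(2) that unfolding X(3) by blast
    show ?thesis
    proof (cases "v1_coeff X = 0")
      case True
      then have "\<exists>Z\<in>form2. similar ?B S (span {Z})"
        using in_form2 X similar_refl by blast
      then show ?thesis
        using True inv v1_coeff_form(1) by blast
    next
      case False
      then have "\<exists>Z\<in>form1 a b c. similar ?B S (span {Z})"
        using similar_form1[OF assms(3) X(1)] unfolding X(3) by blast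
      then show ?thesis
        using False inv v1_coeff_form(2) by blast
    qed
  qed
  then show "(\<exists>Z\<in>form1 a b c. similar ?B S (span {Z})) \<noteq> (\<exists>Z\<in>form2. similar ?B S (span {Z}))"
    if "one_dim_subalgebra (span ?B) S" for S
    using that .
  show "\<exists>R\<subseteq>?F. Z \<in> R \<and> optimal_system ?B R" if "Z \<in> ?F" for Z
  proof (rule optimal_system_exists[OF _ _ _ that])
    show "one_dim_subalgebra (span ?B) (span {V})" if "V \<in> ?F" for V
      using one_dim_subalgebra_L5[OF assms(3)] form_in_L5 that by blast
    show "\<exists>Z\<in>?F. similar ?B S (span {Z})" if "one_dim_subalgebra (span ?B) S" for S
      using dichotomy[OF that] by blast
    show "similar ?B T S" if "one_dim_subalgebra (span ?B) S" "similar ?B S T" for S T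
      using that similar_L5_sym[OF assms(3)] unfolding one_dim_subalgebra_def by blast
  qed
  fix Z Z' assume Z: "Z \<in> ?F" and Z': "Z' \<in> ?F"
  note ZL = form_in_L5(1)[OF Z]
  show "similar ?B (span {Z}) (span {Z'}) \<longleftrightarrow> (\<exists>\<epsilon>. Ad_exp \<epsilon> (v1 a b c) ` span {Z} = span {Z'})"
  proof
    assume "\<exists>\<epsilon>. Ad_exp \<epsilon> (v1 a b c) ` span {Z} = span {Z'}"
    then show "similar ?B (span {Z}) (span {Z'})"
      unfolding similar_def using Ad_exp_in_adjoint_group[of "v1 a b c" ?B]
      by (auto simp: L5_basis_def)
  next
    assume sim: "similar ?B (span {Z}) (span {Z'})"
    then have iff: "v1_coeff Z = 0 \<longleftrightarrow> v1_coeff Z' = 0"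
      using similar_L5_v1_coeff[OF assms(3) ZL] form_in_L5(2)[OF Z'] by blast
    show "\<exists>\<epsilon>. Ad_exp \<epsilon> (v1 a b c) ` span {Z} = span {Z'}"
    proof (cases "v1_coeff Z = 0")
      case True
      obtain \<phi> where \<phi>: "\<phi> \<in> adjoint_group ?B" "\<phi> ` span {Z} = span {Z'}"
        using sim unfolding similar_def by blast
      obtain \<epsilon> where \<epsilon>: "\<forall>Y\<in>span ?B. v1_coeff Y = 0 \<longrightarrow> \<phi> Y = Ad_exp \<epsilon> (v1 a b c) Y"
        using adjoint_group_on_ideal[OF assms(3) \<phi>(1)] by blast
      \<comment> \<open>All multiples of \<open>Z\<close> have zero first coordinate, so \<phi> and
        the flow of \<open>v1\<close> agree on the whole line.\<close>
      have "Ad_exp \<epsilon> (v1 a b c) ` span {Z} = \<phi> ` span {Z}"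
        by (rule image_cong) (use \<epsilon> True ZL in \<open>auto simp: span_singleton span_scale\<close>)
      then show ?thesis
        using \<phi>(2) by (intro exI[of _ \<epsilon>]) simp
    next
      case False
      then have "Z \<in> form1 a b c" "Z' \<in> form1 a b c"
        using iff Z Z' v1_coeff_form(2) by blast+
      then obtain k k' where k: "k \<noteq> 0" "Z = k *\<^sub>R v1 a b c" "k' \<noteq> 0" "Z' = k' *\<^sub>R v1 a b c"
        unfolding form1_def by blast
      have v1: "v1 a b c \<in> ?B"
        by (simp add: L5_basis_def)
      \<comment> \<open>Both lines equal the span of \<open>v1 a b c\<close>, so parameter 0
        suffices. Its map is still defined by a series, and \<open>Ad_exp_v1\<close> evaluates
        it.\<close>
      have "Ad_exp 0 (v1 a b c) ` span {v1 a b c} = span {Ad_exp 0 (v1 a b c) (v1 a b c)}"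
        using adjoint_group_L5_image_span[OF assms(3) Ad_exp_in_adjoint_group span_base] v1 by blast
      also have "Ad_exp 0 (v1 a b c) (v1 a b c) = v1 a b c"
        using Ad_exp_v1[OF assms(3), of 0 a b 1 0 0 0 0]
        by (simp flip: generators_eq_L5_elem(1))
      finally show ?thesis
        using k by (intro exI[of _ 0]) (simp add: span_scaleR_singleton)
    qed
  qed
qed

end
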